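(* Assume $\mathrm{MA}_\alpha$. Let $\{M_i:i<\alpha\}$ be a collection of pairwise cofinal submodels of $M$. Suppose that $M_0$ is principal and that $\mathcal U_0=\{X\subseteq\omega:a_0\in{}^*X\}$ is a $P_{\mathfrak c}$-point, where $a_0$ generates $M_0$. Then $\bigcap_{i<\alpha}M_i$ contains a principal submodel of $M$ cofinal with each $M_i$.
   Context: $\mathfrak c$ is the cardinality of the continuum. $\mathrm{MA}_\alpha$ is the statement: for every partial order $P$ satisfying the countable chain condition and every collection $\{D_i:i<\alpha\}$ of dense subsets of $P$, there is a filter $G\subseteq P$ meeting every $D_i$. Let $L$ be the language with a symbol for every relation and every function on $\omega$, and let $N$ be the standard $L$-structure with domain $\omega$ in which each symbol denotes itself. Let $M$ be a fixed elementary extension of $N$; for a relation $R$ (e.g. a set $X\subseteq\omega$) or function $f$ on $\omega$, ${}^*R$, ${}^*f$ denote their interpretations in $M$, and ${}^*\!\le$ is the interpretation of the usual order. A submodel of $M$ means an elementary submodel. For $a\in M$, the set $\{{}^*f(a):f\in\omega^\omega\}$ is the domain of an elementary submodel of $M$, called the principal submodel generated by $a$; a submodel is principal if it is generated by some single element. Two sets $A,B\subseteq M$ are cofinal with each other if for every $a\in A$ there is $b\in B$ with $a\,{}^*\!\!\le b$ and for every $b\in B$ there is $a\in A$ with $b\,{}^*\!\!\le a$. An ultrafilter $\mathcal U$ on $\omega$ is a $P_{\mathfrak c}$-point if for every $\beta<\mathfrak c$ and every $\{a_i:i<\beta\}\subseteq\mathcal U$ there is $a\in\mathcal U$ with $a\setminus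 a_i$ finite for all $i<\beta$. *)

theory Defs
  imports Complex_Main "HOL-Library.FuncSet"
begin

unbundle cardinal_syntax

text \<open>
  A function symbol is a pair \<open>(n, f)\<close> with \<open>f\<close> an \<open>n\<close>-ary function on \<open>nat\<close>, given on
  lists of length \<open>n\<close> and \<open>undefined\<close> elsewhere, so that distinct symbols denote distinct
  functions. A relation symbol is a pair \<open>(n, R)\<close> with \<open>R\<close> a set of lists of length \<open>n\<close>.
\<close>

type_synonym fsym = "nat \<times> (nat list \<Rightarrow> nat)"
type_synonym rsym = "nat \<times> nat list set"

definition L_funs :: "fsym set" where
  "L_funs = {(n, f). f \<in> extensional {xs. length xs = n}}"

definition L_rels :: "rsym set" where
  "L_rels = {(n, R). R \<subseteq> {xs. length xs = n}}"

datatype tm = Var nat | Fn fsym "tm list"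

datatype fm = Eq tm tm | Rl rsym "tm list" | Neg fm | Conj fm fm | Ex nat fm

primrec L_term :: "tm \<Rightarrow> bool" where
  "L_term (Var x) \<longleftrightarrow> True"
| "L_term (Fn F ts) \<longleftrightarrow> F \<in> L_funs \<and> length ts = fst F \<and> list_all L_term ts"

primrec L_formula :: "fm \<Rightarrow> bool" where
  "L_formula (Eq t u) \<longleftrightarrow> L_term t \<and> L_term u"
| "L_formula (Rl R ts) \<longleftrightarrow> R \<in> L_rels \<and> length ts = fst R \<and> list_all L_term ts"
| "L_formula (Neg \<phi>) \<longleftrightarrow> L_formula \<phi>"
| "L_formula (Conj \<phi> \<psi>) \<longleftrightarrow> L_formula \<phi> \<and> L_formula \<psi>"
| "L_formula (Ex x \<phi>) \<longleftrightarrow> L_formula \<phi>"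

record 'm struct =
  Dom :: "'m set"
  fint :: "fsym \<Rightarrow> 'm list \<Rightarrow> 'm"
  rint :: "rsym \<Rightarrow> 'm list set"

text \<open>Only the values of \<open>fint\<close> and \<open>rint\<close> at symbols of the language and at lists over the
  domain of the right length are relevant.\<close>

definition L_structure :: "'m struct \<Rightarrow> bool" where
  "L_structure M \<longleftrightarrow> Dom M \<noteq> {} \<and>
    (\<forall>F\<in>L_funs. \<forall>as. length as = fst F \<and> set as \<subseteq> Dom M \<longrightarrow> fint M F as \<in> Dom M)"

primrec tm_val :: "'m struct \<Rightarrow> (nat \<Rightarrow> 'm) \<Rightarrow> tm \<Rightarrow> 'm" where
  "tm_val M s (Var x) = s x"
| "tm_val M s (Fn F ts) = fint M F (map (tm_val M s) ts)"

primrec sat :: "'m struct \<Rightarrow> (nat \<Rightarrow> 'm) \<Rightarrow> fm \<Rightarrow> bool" where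
  "sat M s (Eq t u) \<longleftrightarrow> tm_val M s t = tm_val M s u"
| "sat M s (Rl R ts) \<longleftrightarrow> map (tm_val M s) ts \<in> rint M R"
| "sat M s (Neg \<phi>) \<longleftrightarrow> \<not> sat M s \<phi>"
| "sat M s (Conj \<phi> \<psi>) \<longleftrightarrow> sat M s \<phi> \<and> sat M s \<psi>"
| "sat M s (Ex x \<phi>) \<longleftrightarrow> (\<exists>a\<in>Dom M. sat M (s(x := a)) \<phi>)"

definition elementary_embedding :: "('k \<Rightarrow> 'm) \<Rightarrow> 'k struct \<Rightarrow> 'm struct \<Rightarrow> bool" where
  "elementary_embedding e K M \<longleftrightarrow>
    L_structure K \<and> L_structure M \<and> e ` Dom K \<subseteq> Dom M \<and>
    (\<forall>\<phi> s. L_formula \<phi> \<and> range s \<subseteq> Dom K \<longrightarrow> (sat K s \<phi> \<longleftrightarrow> sat M (e \<circ> s) \<phi>))"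

definition std_model :: "nat struct" where
  "std_model = \<lparr>Dom = UNIV, fint = (\<lambda>F. snd F), rint = (\<lambda>R. snd R)\<rparr>"

text \<open>Submodels are always elementary and are identified with their domains.\<close>

definition submodel :: "'m struct \<Rightarrow> 'm set \<Rightarrow> bool" where
  "submodel M S \<longleftrightarrow> S \<subseteq> Dom M \<and> elementary_embedding (\<lambda>x. x) (M\<lparr>Dom := S\<rparr>) M"

definition star_set :: "'m struct \<Rightarrow> nat set \<Rightarrow> 'm set" where
  "star_set M X = {a \<in> Dom M. [a] \<in> rint M (1, {[x] | x. x \<in> X})}"

definition star_fun :: "'m struct \<Rightarrow> (nat \<Rightarrow> nat) \<Rightarrow> 'm \<Rightarrow> 'm" where
  "star_fun M f a = fint M (1, restrict (\<lambda>xs. f (hd xs)) {xs. length xs = 1}) [a]"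

definition star_le :: "'m struct \<Rightarrow> 'm \<Rightarrow> 'm \<Rightarrow> bool" where
  "star_le M a b \<longleftrightarrow> [a, b] \<in> rint M (2, {[x, y] | x y. x \<le> y})"

definition generated :: "'m struct \<Rightarrow> 'm \<Rightarrow> 'm set" where
  "generated M a = {star_fun M f a | f. True}"

definition principal_submodel :: "'m struct \<Rightarrow> 'm set \<Rightarrow> bool" where
  "principal_submodel M S \<longleftrightarrow> submodel M S \<and> (\<exists>a\<in>Dom M. S = generated M a)"

definition cofinal_with :: "'m struct \<Rightarrow> 'm set \<Rightarrow> 'm set \<Rightarrow> bool" where
  "cofinal_with M A B \<longleftrightarrow>
    (\<forall>a\<in>A. \<exists>b\<in>B. star_le M a b) \<and> (\<forall>b\<in>B. \<exists>a\<in>A. star_le M b a)"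

text \<open>Principal ultrafilters are not excluded.\<close>

definition ultrafilter_on_nat :: "nat set set \<Rightarrow> bool" where
  "ultrafilter_on_nat U \<longleftrightarrow> UNIV \<in> U \<and> {} \<notin> U \<and>
    (\<forall>X Y. X \<in> U \<and> Y \<in> U \<longrightarrow> X \<inter> Y \<in> U) \<and>
    (\<forall>X Y. X \<in> U \<and> X \<subseteq> Y \<longrightarrow> Y \<in> U) \<and>
    (\<forall>X. X \<in> U \<or> - X \<in> U)"

text \<open>A family indexed by an ordinal below the continuum is replaced by its set of members.\<close>

definition Pc_point :: "nat set set \<Rightarrow> bool" where
  "Pc_point U \<longleftrightarrow> ultrafilter_on_nat U \<and>
    (\<forall>A. A \<subseteq> U \<and> |A| <o |UNIV :: real set| \<longrightarrow> (\<exists>a\<in>U. \<forall>b\<in>A. finite (a - b)))"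

text \<open>In a pair \<open>(p, q) \<in> r\<close> the element \<open>p\<close> is the smaller one (the stronger condition).\<close>

definition compatible :: "'p set \<Rightarrow> 'p rel \<Rightarrow> 'p \<Rightarrow> 'p \<Rightarrow> bool" where
  "compatible P r p q \<longleftrightarrow> (\<exists>u\<in>P. (u, p) \<in> r \<and> (u, q) \<in> r)"

definition ccc :: "'p set \<Rightarrow> 'p rel \<Rightarrow> bool" where
  "ccc P r \<longleftrightarrow>
    (\<forall>A\<subseteq>P. (\<forall>p\<in>A. \<forall>q\<in>A. p \<noteq> q \<longrightarrow> \<not> compatible P r p q) \<longrightarrow> |A| \<le>o natLeq)"

definition dense_in :: "'p set \<Rightarrow> 'p rel \<Rightarrow> 'p set \<Rightarrow> bool" where
  "dense_in P r D \<longleftrightarrow> D \<subseteq> P \<and> (\<forall>p\<in>P. \<exists>d\<in>D. (d, p) \<in> r)"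

definition filter_in :: "'p set \<Rightarrow> 'p rel \<Rightarrow> 'p set \<Rightarrow> bool" where
  "filter_in P r G \<longleftrightarrow> G \<subseteq> P \<and> G \<noteq> {} \<and>
    (\<forall>p\<in>G. \<forall>q\<in>P. (p, q) \<in> r \<longrightarrow> q \<in> G) \<and>
    (\<forall>p\<in>G. \<forall>q\<in>G. \<exists>u\<in>G. (u, p) \<in> r \<and> (u, q) \<in> r)"

text \<open>
  Ordinals are given as well-orders \<open>\<alpha>\<close>, and \<open>i < \<alpha>\<close> becomes \<open>i \<in> Field \<alpha>\<close>.

  HOL has no quantification over types, so the partial orders in \<open>MA\<close> range over all those
  whose underlying set is a set of elements of \<open>'p\<close>. As soon as \<open>'p\<close> has at least continuum
  many elements this is Martin's axiom for all partial orders: if \<open>\<alpha>\<close> has cardinality below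
  the continuum, a Loewenheim-Skolem argument reduces an arbitrary ccc order to a suborder
  with at most \<open>max \<bar>\<alpha>\<bar> \<aleph>\<^sub>0\<close> elements; if not, both versions are refuted by the countable
  order of finite binary sequences.
\<close>

definition MA :: "'p itself \<Rightarrow> 'i rel \<Rightarrow> bool" where
  "MA TYPE('p) \<alpha> \<longleftrightarrow>
    (\<forall>(P :: 'p set) r (D :: 'i \<Rightarrow> 'p set).
      P \<noteq> {} \<and> partial_order_on P r \<and> ccc P r \<and> (\<forall>i\<in>Field \<alpha>. dense_in P r (D i)) \<longrightarrow>
      (\<exists>G. filter_in P r G \<and> (\<forall>i\<in>Field \<alpha>. G \<inter> D i \<noteq> {})))"

end

theory Submission
  imports Defs "HOL-Analysis.Abstract_Topology_2"
begin

text \<open>Let \<open>b\<^sub>i \<in> M\<^sub>i\<close> and \<open>g\<^sub>i\<close> satisfy \<open>a\<^sub>0 \<le> b\<^sub>i \<le> g\<^sub>i(a\<^sub>0)\<close>. By Martin's axiom, applied to Hechler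
  forcing, one \<open>g\<close> eventually dominates all \<open>g\<^sub>i\<close>, so \<open>a\<^sub>0 \<le> b\<^sub>i \<le> g(a\<^sub>0)\<close> for all \<open>i\<close> when
  \<open>a\<^sub>0\<close> is nonstandard. Cut \<open>\<omega>\<close> into intervals that grow faster than \<open>g\<close>; merging them in pairs
  with the right parity gives a finite-to-one \<open>f\<close> with \<open>f(a\<^sub>0) = f(b\<^sub>i) \<in> M\<^sub>i\<close> for all \<open>i\<close>, and
  \<open>f(a\<^sub>0)\<close> generates a submodel cofinal with \<open>M\<^sub>0\<close>. If \<open>a\<^sub>0\<close> is standard, \<open>M\<^sub>0\<close> is contained in every
  \<open>M\<^sub>i\<close>.\<close>

section \<open>Martin's axiom and domination\<close>

text \<open>An order on \<open>'q\<close> is copied to the image of \<open>\<iota>\<close>, where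
  chain condition, density and filters mean the same. This moves the axiom from \<open>'p\<close> to
  the type of Hechler conditions.\<close>

lemma MA_inj:
  fixes \<iota> :: "'q \<Rightarrow> 'p" and \<alpha> :: "'i rel"
  assumes MA: "MA TYPE('p) \<alpha>" and inj: "inj \<iota>"
  shows "MA TYPE('q) \<alpha>"
  unfolding MA_def
proof (intro allI impI)
  fix P :: "'q set" and r and D :: "'i \<Rightarrow> 'q set"
  assume A: "P \<noteq> {} \<and> partial_order_on P r \<and> ccc P r \<and> (\<forall>i\<in>Field \<alpha>. dense_in P r (D i))"
  define r' where "r' = map_prod \<iota> \<iota> ` r"
  have r': "(\<iota> x, \<iota> y) \<in> r' \<longleftrightarrow> (x, y) \<in> r" for x y
    using inj by (auto simp: r'_def inj_def)
  have "partial_order_on (\<iota> ` P) r'"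
    unfolding partial_order_on_def preorder_on_def
  proof (intro conjI)
    have po: "r \<subseteq> P \<times> P" "refl_on P r" "trans r" "antisym r"
      using A by (auto simp: partial_order_on_def preorder_on_def)
    show "refl_on (\<iota> ` P) r'" "r' \<subseteq> \<iota> ` P \<times> \<iota> ` P"
      using po by (auto simp: refl_on_def r'_def)
    show "trans r'"
    proof (rule transI)
      fix p q s
      assume "(p, q) \<in> r'" "(q, s) \<in> r'"
      then obtain x y w where eqs: "p = \<iota> x" "s = \<iota> w" and "(x, y) \<in> r" "(y, w) \<in> r"
        unfolding r'_def by (auto simp: inj_eq[OF inj])
      then have "(x, w) \<in> r"
        using po(3) by (blast dest: transD)
      then show "(p, s) \<in> r'"
        unfolding eqs r' .
    qed
    show "antisym r'"
    proof (rule antisymI)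
      fix p q
      assume "(p, q) \<in> r'" "(q, p) \<in> r'"
      then obtain x y where "p = \<iota> x" "q = \<iota> y" "(x, y) \<in> r" "(y, x) \<in> r"
        unfolding r'_def by (auto simp: inj_eq[OF inj])
      then show "p = q"
        using po(4) by (blast dest: antisymD)
    qed
  qed
  moreover have "ccc (\<iota> ` P) r'"
    unfolding ccc_def
  proof (intro allI impI)
    fix A'
    assume "A' \<subseteq> \<iota> ` P"
      and anti: "\<forall>p\<in>A'. \<forall>q\<in>A'. p \<noteq> q \<longrightarrow> \<not> compatible (\<iota> ` P) r' p q"
    then obtain B where B: "B \<subseteq> P" "A' = \<iota> ` B"
      by (meson subset_imageE)
    have "\<forall>p\<in>B. \<forall>q\<in>B. p \<noteq> q \<longrightarrow> \<not> compatible P r p q"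
      using anti B(2) by (auto simp: compatible_def r' inj_eq[OF inj])
    then have "|B| \<le>o natLeq"
      using A B by (auto simp: ccc_def)
    then show "|A'| \<le>o natLeq"
      using B card_of_image ordLeq_transitive by blast
  qed
  moreover have "\<forall>i\<in>Field \<alpha>. dense_in (\<iota> ` P) r' (\<iota> ` D i)"
    using A by (auto simp: dense_in_def r' image_subset_iff)
  ultimately obtain G where G: "filter_in (\<iota> ` P) r' G" "\<forall>i\<in>Field \<alpha>. G \<inter> \<iota> ` D i \<noteq> {}"
    using MA[unfolded MA_def, rule_format, of "\<iota> ` P" r' "\<lambda>i. \<iota> ` D i"] A by auto
  from G(1) have sub: "G \<subseteq> \<iota> ` P" and ne: "G \<noteq> {}"
    and up: "\<And>p q. p \<in> G \<Longrightarrow> q \<in> P \<Longrightarrow> (p, \<iota> q) \<in> r' \<Longrightarrow> \<iota> q \<in> G"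
    and dir: "\<And>p q. p \<in> G \<Longrightarrow> q \<in> G \<Longrightarrow> \<exists>u\<in>G. (u, p) \<in> r' \<and> (u, q) \<in> r'"
    unfolding filter_in_def by simp_all
  have "filter_in P r (\<iota> -` G)"
    unfolding filter_in_def
  proof (intro conjI ballI impI)
    show "\<iota> -` G \<subseteq> P"
    proof
      fix x
      assume "x \<in> \<iota> -` G"
      then have "\<iota> x \<in> \<iota> ` P"
        using sub by auto
      then show "x \<in> P"
        by (simp add: inj_image_mem_iff[OF inj])
    qed
    show "\<iota> -` G \<noteq> {}"
      using sub ne by blast
    show "q \<in> \<iota> -` G" if "p \<in> \<iota> -` G" "q \<in> P" "(p, q) \<in> r" for p q
      using up[of "\<iota> p" q] that by (simp add: r')
    show "\<exists>u\<in>\<iota> -` G. (u, p) \<in> r \<and> (u, q) \<in> r" if pq: "p \<in> \<iota> -` G" "q \<in> \<iota> -` G" for p q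
    proof -
      obtain u where u: "u \<in> G" "(u, \<iota> p) \<in> r'" "(u, \<iota> q) \<in> r'"
        using dir[of "\<iota> p" "\<iota> q"] pq by auto
      moreover obtain v where "u = \<iota> v"
        using sub u(1) by blast
      ultimately show ?thesis
        by (auto simp: r')
    qed
  qed
  moreover have "\<forall>i\<in>Field \<alpha>. \<iota> -` G \<inter> D i \<noteq> {}"
    using G(2) by blast
  ultimately show "\<exists>G. filter_in P r G \<and> (\<forall>i\<in>Field \<alpha>. G \<inter> D i \<noteq> {})"
    by (intro exI conjI)
qed

text \<open>A pair becomes the sequence with the code of \<open>s\<close> at 0, followed by
  \<open>f\<close>; the graph of that sequence is a set of naturals and hence coded by a
  real.\<close>

lemma inj_nat_list_fun_real: "\<exists>\<iota> :: nat list \<times> (nat \<Rightarrow> nat) \<Rightarrow> real. inj \<iota>"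
proof -
  define j :: "nat list \<times> (nat \<Rightarrow> nat) \<Rightarrow> nat set"
    where "j = (\<lambda>(s, f). range (\<lambda>n. prod_encode (n, case n of 0 \<Rightarrow> to_nat s | Suc m \<Rightarrow> f m)))"
  have "inj j"
  proof (rule injI, clarify)
    fix s t and f g :: "nat \<Rightarrow> nat"
    assume eq: "j (s, f) = j (t, g)"
    have "(case n of 0 \<Rightarrow> to_nat s | Suc m \<Rightarrow> f m) = (case n of 0 \<Rightarrow> to_nat t | Suc m \<Rightarrow> g m)" for n
    proof -
      have "prod_encode (n, case n of 0 \<Rightarrow> to_nat s | Suc m \<Rightarrow> f m) \<in> j (t, g)"
        using eq by (auto simp: j_def)
      then show ?thesis
        by (auto simp: j_def)
    qed
    from this[of 0] this[of "Suc _"] show "s = t \<and> f = g"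
      by auto
  qed
  moreover obtain k :: "nat set \<Rightarrow> real" where "inj k"
    using nat_sets_eqpoll_reals by (auto simp: eqpoll_def bij_betw_def)
  ultimately have "inj (k \<circ> j)"
    by (rule inj_compose[rotated])
  then show ?thesis
    by blast
qed

text \<open>Hechler forcing: a condition \<open>(s, f)\<close> is a finite initial segment \<open>s\<close> of the generic function
  together with the promise that its later values stay above \<open>f\<close>.\<close>

definition hechler :: "(nat list \<times> (nat \<Rightarrow> nat)) rel" where
  "hechler = {((t, g), (s, f)). length s \<le> length t \<and> (\<forall>n<length s. t ! n = s ! n) \<and>
     (\<forall>n\<ge>length s. n < length t \<longrightarrow> f n \<le> t ! n) \<and> (\<forall>n. f n \<le> g n)}"

lemma partial_order_hechler: "partial_order_on UNIV hechler"
  unfolding partial_order_on_def preorder_on_def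
proof (intro conjI)
  show "refl hechler"
    by (auto simp: refl_on_def hechler_def)
  show "trans hechler"
  proof (rule transI, clarify)
    fix s t u and f g h :: "nat \<Rightarrow> nat"
    assume 1: "((u, h), (t, g)) \<in> hechler" and 2: "((t, g), (s, f)) \<in> hechler"
    have "f n \<le> u ! n" if "length s \<le> n" "n < length u" for n
    proof (cases "n < length t")
      case False
      then have "g n \<le> u ! n" "f n \<le> g n"
        using 1 2 that by (simp_all add: hechler_def)
      then show ?thesis
        by simp
    qed (use 1 2 that in \<open>simp add: hechler_def\<close>)
    then show "((u, h), (s, f)) \<in> hechler"
      using 1 2 by (auto simp: hechler_def intro: le_trans)
  qed
  show "antisym hechler"
    by (rule antisymI) (auto simp: hechler_def fun_eq_iff intro!: nth_equalityI le_antisym)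
qed simp

text \<open>Two conditions with the same stem are compatible through the maximum of their promises,
  so an antichain injects into the finite sequences.\<close>

lemma ccc_hechler: "ccc UNIV hechler"
  unfolding ccc_def
proof (intro allI impI)
  fix A
  assume anti: "\<forall>p\<in>A. \<forall>q\<in>A. p \<noteq> q \<longrightarrow> \<not> compatible UNIV hechler p q"
  have "compatible UNIV hechler (s, f) (s, g)" for s f g
    unfolding compatible_def
    by (rule bexI[of _ "(s, \<lambda>n. max (f n) (g n))"]) (auto simp: hechler_def)
  then have "inj_on fst A"
    using anti by (intro inj_onI) (metis prod.collapse)
  then have "inj_on (to_nat \<circ> fst) A"
    by (simp add: comp_inj_on)
  then have "|A| \<le>o |UNIV :: nat set|"
    using card_of_ordLeq by blast
  then show "|A| \<le>o natLeq"
    using card_of_nat ordLeq_ordIso_trans by blast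
qed

lemma MA_hechler_filter:
  fixes G :: "'i \<Rightarrow> nat \<Rightarrow> nat" and l :: "'i \<Rightarrow> nat" and \<alpha> :: "'i rel"
  assumes "MA TYPE(nat list \<times> (nat \<Rightarrow> nat)) \<alpha>"
  obtains F where "filter_in UNIV hechler F"
    and "\<And>i. i \<in> Field \<alpha> \<Longrightarrow> \<exists>(s, f)\<in>F. l i \<le> length s \<and> (\<forall>n. G i n \<le> f n)"
proof -
  define D :: "'i \<Rightarrow> (nat list \<times> (nat \<Rightarrow> nat)) set"
    where "D i = {(s, f). l i \<le> length s \<and> (\<forall>n. G i n \<le> f n)}" for i
  have "dense_in UNIV hechler (D i)" for i
    unfolding dense_in_def
  proof (intro conjI ballI)
    fix p :: "nat list \<times> (nat \<Rightarrow> nat)"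
    obtain s :: "nat list" and f where p: "p = (s, f)"
      by fastforce
    \<comment> \<open>Filling up the stem with values of \<open>f\<close> itself keeps the promise
      of \<open>p\<close>; nothing is added if \<open>s\<close> is already long enough.\<close>
    let ?d = "(s @ map f [length s..<l i], \<lambda>n. max (f n) (G i n))"
    have "?d \<in> D i" "(?d, p) \<in> hechler"
      by (auto simp: D_def hechler_def p nth_append)
    then show "\<exists>d\<in>D i. (d, p) \<in> hechler"
      by blast
  qed simp
  then obtain F where F: "filter_in UNIV hechler F" "\<forall>i\<in>Field \<alpha>. F \<inter> D i \<noteq> {}"
    using assms partial_order_hechler ccc_hechler unfolding MA_def
    by (metis UNIV_not_empty)
  show thesis
  proof (rule that[OF F(1)])
    show "\<exists>(s, f)\<in>F. l i \<le> length s \<and> (\<forall>n. G i n \<le> f n)" if "i \<in> Field \<alpha>" for i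
      using F(2) that unfolding D_def by blast
  qed
qed

text \<open>For infinite \<open>Field \<alpha>\<close>, \<open>g\<close> is the union of the stems
  in the filter: past the stem of a condition whose promise is above \<open>G i\<close>, all values
  of \<open>g\<close> keep that promise.\<close>

lemma MA_dominating:
  fixes G :: "'i \<Rightarrow> nat \<Rightarrow> nat" and \<alpha> :: "'i rel"
  assumes MA: "MA TYPE('p) \<alpha>" and "|UNIV :: real set| \<le>o |UNIV :: 'p set|"
  shows "\<exists>g. \<forall>i\<in>Field \<alpha>. \<exists>k. \<forall>n\<ge>k. G i n \<le> g n"
proof (cases "finite (Field \<alpha>)")
  \<comment> \<open>Meeting finitely many dense sets does not make the stems arbitrarily long, so
    here a sum serves as the bound.\<close>
  case True
  then show ?thesis
    by (intro exI[of _ "\<lambda>n. \<Sum>i\<in>Field \<alpha>. G i n"]) (auto intro: member_le_sum)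
next
  case False
  obtain \<kappa> :: "real \<Rightarrow> 'p" where "inj \<kappa>"
    using assms(2) card_of_ordLeq[of "UNIV :: real set" "UNIV :: 'p set"] by auto
  moreover obtain \<iota> :: "nat list \<times> (nat \<Rightarrow> nat) \<Rightarrow> real" where "inj \<iota>"
    using inj_nat_list_fun_real by blast
  ultimately have MA': "MA TYPE(nat list \<times> (nat \<Rightarrow> nat)) \<alpha>"
    using MA_inj[OF MA, of "\<kappa> \<circ> \<iota>"] by (simp add: inj_compose)
  \<comment> \<open>There is one requirement for each index \<open>i\<close> and each stem length
    \<open>l\<close>; \<open>Field \<alpha>\<close>, being infinite, can enumerate them.\<close>
  have "|Field \<alpha> \<times> (UNIV :: nat set)| =o |Field \<alpha>|"
    using False by (intro card_of_Times_infinite_simps) (auto simp: infinite_iff_card_of_nat)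
  then obtain \<phi> where \<phi>: "bij_betw \<phi> (Field \<alpha>) (Field \<alpha> \<times> (UNIV :: nat set))"
    using card_of_ordIso ordIso_symmetric by blast
  obtain F where F: "filter_in UNIV hechler F"
    and D: "\<And>i. i \<in> Field \<alpha> \<Longrightarrow>
      \<exists>(s, f)\<in>F. snd (\<phi> i) \<le> length s \<and> (\<forall>n. G (fst (\<phi> i)) n \<le> f n)"
    by (rule MA_hechler_filter[OF MA', of "\<lambda>i. snd (\<phi> i)" "\<lambda>i. G (fst (\<phi> i))"]) blast
  have D': "\<exists>(s, f)\<in>F. l \<le> length s \<and> (\<forall>n. G i n \<le> f n)" if "i \<in> Field \<alpha>" for i l
  proof -
    have "(i, l) \<in> \<phi> ` Field \<alpha>"
      using that \<phi> by (simp add: bij_betw_def)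
    then obtain j where "j \<in> Field \<alpha>" "\<phi> j = (i, l)"
      by auto
    then show ?thesis
      using D[of j] by simp
  qed
  have comp: "\<exists>u\<in>F. (u, p) \<in> hechler \<and> (u, q) \<in> hechler" if "p \<in> F" "q \<in> F" for p q
    using F that unfolding filter_in_def by blast
  \<comment> \<open>Any two stems in the filter have a common extension, so at most one
    \<open>m\<close> qualifies.\<close>
  define g where "g n = (SOME m. \<exists>(s, f)\<in>F. n < length s \<and> s ! n = m)" for n
  have g: "g n = s ! n" if sf: "(s, f) \<in> F" and n: "n < length s" for s f n
  proof -
    have "\<exists>(t, h)\<in>F. n < length t \<and> t ! n = g n"
      unfolding g_def by (rule someI_ex) (use sf n in auto)
    then obtain t h where t: "(t, h) \<in> F" "n < length t" "t ! n = g n"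
      by blast
    obtain u where "(u, (s, f)) \<in> hechler" "(u, (t, h)) \<in> hechler"
      using comp[OF sf t(1)] by blast
    then show ?thesis
      using n t by (auto simp: hechler_def)
  qed
  have "\<exists>k. \<forall>n\<ge>k. G i n \<le> g n" if i: "i \<in> Field \<alpha>" for i
  proof -
    obtain s f where sf: "(s, f) \<in> F" "\<And>n. G i n \<le> f n"
      using D'[OF i, of 0] by auto
    have "G i n \<le> g n" if n: "length s \<le> n" for n
    proof -
      \<comment> \<open>A stem reaching past \<open>n\<close> ensures that the common extension
        \<open>u\<close> decides the value at \<open>n\<close>; as \<open>n\<close> is past
        \<open>s\<close>, this value is at least \<open>f n\<close>.\<close>
      obtain t h where t: "(t, h) \<in> F" "Suc n \<le> length t"
        using D'[OF i, of "Suc n"] by auto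
      obtain u k where u: "(u, k) \<in> F" "((u, k), (s, f)) \<in> hechler" "((u, k), (t, h)) \<in> hechler"
        using comp[OF sf(1) t(1)] by auto
      then have "n < length u"
        using t by (auto simp: hechler_def)
      moreover from this have "f n \<le> u ! n"
        using u(2) n by (auto simp: hechler_def)
      ultimately show ?thesis
        using g[OF u(1)] sf(2)[of n] by fastforce
    qed
    then show ?thesis
      by blast
  qed
  then show ?thesis
    by blast
qed

section \<open>An interval partition\<close>

text \<open>If \<open>x\<close> lies in the \<open>k\<close>-th interval, every \<open>y \<in> {x..g x}\<close> lies in the \<open>k\<close>-th or the
  \<open>(k + 1)\<close>-st one; so \<open>x\<close> and \<open>y\<close> get the same label once the intervals are merged in pairs
  with the parity determined by \<open>x\<close>.\<close>

lemma interval_partition: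
  fixes g :: "nat \<Rightarrow> nat"
  obtains f :: "bool \<Rightarrow> nat \<Rightarrow> nat" and E :: "nat set" and u :: "nat \<Rightarrow> nat"
  where "\<And>x y. x \<le> y \<Longrightarrow> y \<le> g x \<Longrightarrow> f (x \<in> E) x = f (x \<in> E) y"
    and "\<And>b x. x \<le> u (f b x)"
proof -
  \<comment> \<open>\<open>G x\<close> exceeds \<open>x\<close> and every \<open>g y\<close> with
    \<open>y \<le> x\<close>; the sum stands in for a maximum. The iterates of \<open>G\<close> at 0
    are the endpoints of the intervals.\<close>
  define G where "G x = Suc (x + (\<Sum>y\<le>x. g y))" for x
  define n where "n k = (G ^^ k) 0" for k
  have n_Suc: "n (Suc k) = G (n k)" for k
    by (simp add: n_def)
  have G_le: "g x \<le> (\<Sum>y\<le>m. g y)" if "x \<le> m" for x m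
    using that by (intro member_le_sum) auto
  have "strict_mono n"
    by (rule strict_mono_Suc_iff[THEN iffD2]) (simp add: n_Suc G_def)
  then have self_le: "k \<le> n k" for k
    by (rule strict_mono_imp_increasing)
  define idx where "idx x = (LEAST k. x < n (Suc k))" for x
  have idx: "x < n (Suc (idx x))" for x
    unfolding idx_def
    by (rule LeastI[of _ x]) (use self_le[of "Suc x"] in simp)
  have idx_le: "idx x \<le> k" if "x < n (Suc k)" for x k
    unfolding idx_def using that by (rule Least_le)
  have idx_mono: "idx x \<le> idx y" if "x \<le> y" for x y
    using that idx[of y] by (intro idx_le) simp
  \<comment> \<open>With \<open>m = n (Suc (idx x))\<close>, the right end of the interval of
    \<open>x\<close>, the value \<open>g x\<close> is below \<open>G m\<close>, which is the next
    endpoint.\<close>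
  have idx_Suc: "idx y \<le> Suc (idx x)" if "y \<le> g x" for x y
    using that G_le[of x "n (Suc (idx x))"] idx[of x]
    by (intro idx_le) (simp add: n_Suc[of "Suc _"] G_def)
  \<comment> \<open>\<open>True\<close> merges the intervals 0 and 1, 2 and 3, and so on;
    \<open>False\<close> merges 1 and 2, 3 and 4, and so on, leaving 0 alone. The first joins even
    intervals to their successors, the second odd ones.\<close>
  define f where "f b x = (if b then idx x div 2 else Suc (idx x) div 2)" for b x
  show thesis
  proof
    show "f (x \<in> {x. even (idx x)}) x = f (x \<in> {x. even (idx x)}) y"
      if "x \<le> y" "y \<le> g x" for x y
    proof -
      have "idx y = idx x \<or> idx y = Suc (idx x)"
        using idx_mono[OF that(1)] idx_Suc[OF that(2)] by linarith
      then show ?thesis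
        unfolding f_def mem_Collect_eq
        by (simp only: split: if_split) presburger
    qed
    \<comment> \<open>The label \<open>m\<close> occurs only in intervals numbered at most
      \<open>2 * m + 1\<close>, all of them below \<open>n (2 * m + 2)\<close>. This bound makes
      \<open>f b\<close> finite-to-one.\<close>
    show "x \<le> n (2 * f b x + 2)" for b x
    proof -
      have "m \<le> Suc (2 * (m div 2))" for m :: nat
        by presburger
      from this[of "idx x"] this[of "Suc (idx x)"] have "Suc (idx x) \<le> 2 * f b x + 2"
        by (simp add: f_def)
      then have "n (Suc (idx x)) \<le> n (2 * f b x + 2)"
        using \<open>strict_mono n\<close> strict_mono_less_eq by blast
      then show ?thesis
        using idx[of x] by linarith
    qed
  qed
qed

section \<open>Transfer\<close>

primrec tm_vars :: "tm \<Rightarrow> nat set" where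
  "tm_vars (Var x) = {x}"
| "tm_vars (Fn F ts) = \<Union> (set (map tm_vars ts))"

text \<open>Bound variables are counted too; the set serves only as a finite bound on the free
  ones.\<close>

primrec fm_vars :: "fm \<Rightarrow> nat set" where
  "fm_vars (Eq t u) = tm_vars t \<union> tm_vars u"
| "fm_vars (Rl R ts) = \<Union> (set (map tm_vars ts))"
| "fm_vars (Neg \<phi>) = fm_vars \<phi>"
| "fm_vars (Conj \<phi> \<psi>) = fm_vars \<phi> \<union> fm_vars \<psi>"
| "fm_vars (Ex x \<phi>) = fm_vars \<phi>"

lemma finite_tm_vars: "finite (tm_vars t)"
  by (induction t) auto

lemma finite_fm_vars: "finite (fm_vars \<phi>)"
  by (induction \<phi>) (auto simp: finite_tm_vars)

lemma tm_val_cong: "(\<And>x. x \<in> tm_vars t \<Longrightarrow> s x = s' x) \<Longrightarrow> tm_val M s t = tm_val M s' t"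
proof (induction t)
  case (Fn F ts)
  have "tm_val M s t = tm_val M s' t" if "t \<in> set ts" for t
    using that by (intro Fn.IH Fn.prems) auto
  then have "map (tm_val M s) ts = map (tm_val M s') ts"
    by simp
  then show ?case
    by (simp only: tm_val.simps)
qed simp

lemma sat_cong: "(\<And>x. x \<in> fm_vars \<phi> \<Longrightarrow> s x = s' x) \<Longrightarrow> sat M s \<phi> \<longleftrightarrow> sat M s' \<phi>"
proof (induction \<phi> arbitrary: s s')
  case (Eq t u)
  have "tm_val M s t = tm_val M s' t" "tm_val M s u = tm_val M s' u"
    by (intro tm_val_cong Eq; simp)+
  then show ?case
    by simp
next
  case (Rl R ts)
  have "tm_val M s t = tm_val M s' t" if "t \<in> set ts" for t
    using that by (intro tm_val_cong Rl) auto
  then have "map (tm_val M s) ts = map (tm_val M s') ts"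
    by simp
  then show ?case
    by (simp only: sat.simps)
next
  case (Neg \<phi>)
  have "sat M s \<phi> \<longleftrightarrow> sat M s' \<phi>"
    by (intro Neg) simp
  then show ?case
    by simp
next
  case (Conj \<phi> \<psi>)
  have "sat M s \<phi> \<longleftrightarrow> sat M s' \<phi>" "sat M s \<psi> \<longleftrightarrow> sat M s' \<psi>"
    by (intro Conj; simp)+
  then show ?case
    by simp
next
  case (Ex x \<phi>)
  have "sat M (s(x := a)) \<phi> \<longleftrightarrow> sat M (s'(x := a)) \<phi>" for a
    by (intro Ex.IH) (simp add: Ex.prems)
  then show ?case
    by simp
qed

text \<open>Elementarity compares only assignments that come from \<omega>. For large
  \<open>n\<close> this closure is a sentence, which can be instantiated in the extension at
  arbitrary elements.\<close>

primrec all_below :: "nat \<Rightarrow> fm \<Rightarrow> fm" where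
  "all_below 0 \<phi> = \<phi>"
| "all_below (Suc n) \<phi> = Neg (Ex n (Neg (all_below n \<phi>)))"

lemma L_formula_all_below: "L_formula \<phi> \<Longrightarrow> L_formula (all_below n \<phi>)"
  by (induction n) auto

lemma sat_all_belowI: "(\<And>s. sat M s \<phi>) \<Longrightarrow> sat M s (all_below n \<phi>)"
  by (induction n arbitrary: s) auto

lemma sat_all_belowD:
  assumes "sat M s (all_below n \<phi>)" "\<And>x. x < n \<Longrightarrow> s' x \<in> Dom M" "\<And>x. n \<le> x \<Longrightarrow> s' x = s x"
  shows "sat M s' \<phi>"
  using assms
proof (induction n arbitrary: s)
  case 0
  then have "s' = s"
    by auto
  with 0 show ?case
    by simp
next
  case (Suc n)
  have "sat M (s(n := s' n)) (all_below n \<phi>)"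
    using Suc.prems(1,2) by simp
  then show ?case
    by (rule Suc.IH) (use Suc.prems(2,3) in auto)
qed

section \<open>Formulas for functions, sets and the order\<close>

definition Imp :: "fm \<Rightarrow> fm \<Rightarrow> fm" where
  "Imp \<phi> \<psi> = Neg (Conj \<phi> (Neg \<psi>))"

definition Iff :: "fm \<Rightarrow> fm \<Rightarrow> fm" where
  "Iff \<phi> \<psi> = Conj (Imp \<phi> \<psi>) (Imp \<psi> \<phi>)"

text \<open>The symbol is the one in \<open>star_fun\<close>; the restriction to lists of length one
  makes it extensional, as \<open>L_funs\<close> demands.\<close>

definition App :: "(nat \<Rightarrow> nat) \<Rightarrow> tm \<Rightarrow> tm" where
  "App f t = Fn (1, restrict (\<lambda>xs. f (hd xs)) {xs. length xs = 1}) [t]"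

definition Mem :: "tm \<Rightarrow> nat set \<Rightarrow> fm" where
  "Mem t X = Rl (1, {[x] | x. x \<in> X}) [t]"

definition Le :: "tm \<Rightarrow> tm \<Rightarrow> fm" where
  "Le t u = Rl (2, {[x, y] | x y. x \<le> y}) [t, u]"

lemma L_formula_derived [simp]:
  "L_formula (Imp \<phi> \<psi>) \<longleftrightarrow> L_formula \<phi> \<and> L_formula \<psi>"
  "L_formula (Iff \<phi> \<psi>) \<longleftrightarrow> L_formula \<phi> \<and> L_formula \<psi>"
  "L_term (App f t) \<longleftrightarrow> L_term t"
  "L_formula (Mem t X) \<longleftrightarrow> L_term t"
  "L_formula (Le t u) \<longleftrightarrow> L_term t \<and> L_term u"
  by (auto simp: Imp_def Iff_def App_def Mem_def Le_def L_funs_def L_rels_def)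

text \<open>The rule for \<open>Mem\<close> has a premise because \<open>star_set\<close> contains
  only elements of the domain, which \<open>sat\<close> does not check.\<close>

lemma sat_derived [simp]:
  "sat M s (Imp \<phi> \<psi>) \<longleftrightarrow> (sat M s \<phi> \<longrightarrow> sat M s \<psi>)"
  "sat M s (Iff \<phi> \<psi>) \<longleftrightarrow> (sat M s \<phi> \<longleftrightarrow> sat M s \<psi>)"
  "tm_val M s (App f t) = star_fun M f (tm_val M s t)"
  "tm_val M s t \<in> Dom M \<Longrightarrow> sat M s (Mem t X) \<longleftrightarrow> tm_val M s t \<in> star_set M X"
  "sat M s (Le t u) \<longleftrightarrow> star_le M (tm_val M s t) (tm_val M s u)"
  by (auto simp: Imp_def Iff_def App_def Mem_def Le_def star_fun_def star_set_def star_le_def)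

lemma star_std_model [simp]:
  "Dom std_model = UNIV"
  "fint std_model F = snd F"
  "rint std_model R = snd R"
  "star_fun std_model f n = f n"
  "n \<in> star_set std_model X \<longleftrightarrow> n \<in> X"
  "star_le std_model m n \<longleftrightarrow> m \<le> n"
  by (auto simp: std_model_def star_fun_def star_set_def star_le_def)

lemma star_fun_Dom: "L_structure M \<Longrightarrow> a \<in> Dom M \<Longrightarrow> star_fun M f a \<in> Dom M"
  by (auto simp: L_structure_def star_fun_def L_funs_def)

lemma submodel_star_fun: "submodel M S \<Longrightarrow> a \<in> S \<Longrightarrow> star_fun M f a \<in> S"
  using star_fun_Dom[of "M\<lparr>Dom := S\<rparr>" a f]
  by (simp add: submodel_def elementary_embedding_def star_fun_def)

lemma submodel_nonempty: "submodel M S \<Longrightarrow> S \<noteq> {}"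
  by (simp add: submodel_def elementary_embedding_def L_structure_def)

section \<open>Consequences of elementarity\<close>

locale elementary_extension =
  fixes M :: "'m struct" and e :: "nat \<Rightarrow> 'm"
  assumes elementary: "elementary_embedding e std_model M"
begin

lemma L_structure: "L_structure M"
  using elementary by (simp add: elementary_embedding_def)

lemmas star_fun_Dom [simp] = star_fun_Dom[OF L_structure]

lemma transfer:
  assumes "L_formula \<phi>" "\<And>s. sat std_model s \<phi>" "\<And>x. s x \<in> Dom M"
  shows "sat M s \<phi>"
proof -
  obtain n where n: "\<And>x. x \<in> fm_vars \<phi> \<Longrightarrow> x < n"
    using finite_fm_vars[of \<phi>] by (auto simp: finite_nat_set_iff_bounded)
  have "sat std_model (\<lambda>_. 0) (all_below n \<phi>)"
    using assms by (intro sat_all_belowI)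
  moreover have "L_formula (all_below n \<phi>)"
    using assms by (intro L_formula_all_below)
  ultimately have "sat M (e \<circ> (\<lambda>_. 0)) (all_below n \<phi>)"
    using elementary by (auto simp: elementary_embedding_def)
  \<comment> \<open>From \<open>n\<close> on the assignment has to remain \<open>e 0\<close>; those
    variables do not occur in \<open>\<phi>\<close>.\<close>
  then have "sat M (\<lambda>x. if x < n then s x else e 0) \<phi>"
    by (rule sat_all_belowD) (use assms in auto)
  then show ?thesis
    using sat_cong[of \<phi> "\<lambda>x. if x < n then s x else e 0" s M] n by simp
qed

lemma star_fun_comp: "a \<in> Dom M \<Longrightarrow> star_fun M f (star_fun M g a) = star_fun M (\<lambda>x. f (g x)) a"
  using transfer[of "Eq (App f (App g (Var 0))) (App (\<lambda>x. f (g x)) (Var 0))" "\<lambda>_. a"] by simp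

lemma star_fun_id: "a \<in> Dom M \<Longrightarrow> star_fun M (\<lambda>x. x) a = a"
  using transfer[of "Eq (App (\<lambda>x. x) (Var 0)) (Var 0)" "\<lambda>_. a"] by simp

lemma star_le_refl: "a \<in> Dom M \<Longrightarrow> star_le M a a"
  using transfer[of "Le (Var 0) (Var 0)" "\<lambda>_. a"] by simp

lemma star_le_trans:
  assumes "star_le M a b" "star_le M b c" and "a \<in> Dom M" "b \<in> Dom M" "c \<in> Dom M"
  shows "star_le M a c"
  using transfer[of "Imp (Conj (Le (Var 0) (Var 1)) (Le (Var 1) (Var 2))) (Le (Var 0) (Var 2))"
      "(\<lambda>_. a)(1 := b, 2 := c)"] assms
  by simp

text \<open>This turns eventual domination into an inequality at every nonstandard element;
  \<open>k = 0\<close> is the pointwise case.\<close>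

lemma star_fun_le:
  assumes "\<And>n. n \<ge> k \<Longrightarrow> f n \<le> g n" and "a \<in> Dom M" "a \<notin> star_set M {..<k}"
  shows "star_le M (star_fun M f a) (star_fun M g a)"
proof -
  have "sat M (\<lambda>_. a) (Imp (Neg (Mem (Var 0) {..<k})) (Le (App f (Var 0)) (App g (Var 0))))"
    by (rule transfer) (use assms in auto)
  then show ?thesis
    using assms by simp
qed

lemma star_set_Compl: "a \<in> Dom M \<Longrightarrow> a \<in> star_set M (- X) \<longleftrightarrow> a \<notin> star_set M X"
  using transfer[of "Iff (Mem (Var 0) (- X)) (Neg (Mem (Var 0) X))" "\<lambda>_. a"] by simp

lemma star_set_empty: "a \<notin> star_set M {}"
proof (cases "a \<in> Dom M")
  case True
  then show ?thesis
    using transfer[of "Neg (Mem (Var 0) {})" "\<lambda>_. a"] by simp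
qed (simp add: star_set_def)

text \<open>An element below \<open>Suc k\<close> but not below \<open>k\<close> equals
  \<open>k\<close>, so elements with a standard bound are standard. Naming them by constant
  functions at \<open>x\<close> puts them into every submodel that contains
  \<open>x\<close>.\<close>

lemma star_set_lessThan_const:
  assumes "a \<in> star_set M {..<k}" "x \<in> Dom M"
  shows "\<exists>m. a = star_fun M (\<lambda>_. m) x"
  using assms(1)
proof (induction k)
  case 0
  then show ?case
    by (simp add: star_set_empty)
next
  case (Suc k)
  have a: "a \<in> Dom M"
    using Suc.prems by (simp add: star_set_def)
  have "sat M ((\<lambda>_. a)(1 := x)) (Imp (Conj (Mem (Var 0) {..<Suc k}) (Neg (Mem (Var 0) {..<k})))
      (Eq (Var 0) (App (\<lambda>_. k) (Var 1))))"
    by (rule transfer) (use a assms in auto)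
  then show ?case
    using Suc a by auto
qed

text \<open>Going through the relation \<open>R\<close> defined by \<open>\<phi>\<close> on \<open>\<omega>\<close> avoids substituting terms into \<open>\<phi>\<close>.\<close>

lemma sat_star_fun:
  assumes "L_formula \<phi>" "c \<in> Dom M"
  shows "sat M (\<lambda>y. star_fun M (\<sigma> y) c) \<phi> \<longleftrightarrow> c \<in> star_set M {n. sat std_model (\<lambda>y. \<sigma> y n) \<phi>}"
    (is "_ \<longleftrightarrow> c \<in> star_set M ?X")
proof -
  obtain k where k: "\<And>x. x \<in> fm_vars \<phi> \<Longrightarrow> x < k"
    using finite_fm_vars[of \<phi>] by (auto simp: finite_nat_set_iff_bounded)
  \<comment> \<open>Entries \<open>xs ! x\<close> with \<open>x \<ge> k\<close> are unspecified, but
    no such variable occurs in \<open>\<phi>\<close>.\<close>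
  define R where "R = {xs. length xs = k \<and> sat std_model (\<lambda>x. xs ! x) \<phi>}"
  have R: "map s [0..<k] \<in> R \<longleftrightarrow> sat std_model s \<phi>" for s
    using sat_cong[of \<phi> "\<lambda>x. map s [0..<k] ! x" s std_model] k by (simp add: R_def)
  have L: "(k, R) \<in> L_rels"
    by (auto simp: L_rels_def R_def)
  have "sat M (\<lambda>y. star_fun M (\<sigma> y) c) (Iff \<phi> (Rl (k, R) (map Var [0..<k])))"
    by (rule transfer) (use assms L R in \<open>simp_all add: list_all_iff o_def\<close>)
  moreover have "sat M (\<lambda>_. c) (Iff (Rl (k, R) (map (\<lambda>i. App (\<sigma> i) (Var 0)) [0..<k])) (Mem (Var 0) ?X))"
    using R by (intro transfer) (use assms L in \<open>simp_all add: list_all_iff o_def\<close>)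
  ultimately show ?thesis
    using assms by (simp add: o_def)
qed

text \<open>Tarski-Vaught with Skolem functions: when the parameters are values at \<open>c\<close>,
  choosing a witness over \<omega> for each \<open>n\<close> defines a function \<open>h\<close>,
  whose value at \<open>c\<close> is a witness in the generated set.\<close>

lemma submodel_generated:
  assumes c: "c \<in> Dom M"
  shows "submodel M (generated M c)"
proof -
  define S where "S = generated M c"
  define K where "K = M\<lparr>Dom := S\<rparr>"
  have K: "Dom K = S" "fint K = fint M" "rint K = rint M"
    by (simp_all add: K_def)
  have S_Dom: "S \<subseteq> Dom M"
    using c by (auto simp: S_def generated_def)
  have list: "\<exists>fs. as = map (\<lambda>f. star_fun M f c) fs" if "set as \<subseteq> S" for as
    using that
  proof (induction as)
    case (Cons a as)
    then obtain f fs where "a = star_fun M f c" "as = map (\<lambda>f. star_fun M f c) fs"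
      by (auto simp: S_def generated_def)
    then show ?case
      by (intro exI[of _ "f # fs"]) simp
  qed simp
  have "L_structure K"
    unfolding L_structure_def K
  proof (intro conjI ballI allI impI)
    show "S \<noteq> {}"
      by (auto simp: S_def generated_def)
    fix F as
    assume F: "F \<in> L_funs" and as: "length as = fst F \<and> set as \<subseteq> S"
    obtain fs where fs: "as = map (\<lambda>f. star_fun M f c) fs"
      using list as by blast
    \<comment> \<open>Composing \<open>F\<close> with the functions \<open>fs\<close> gives a unary
      function on \<omega>, so the result is again a value at \<open>c\<close>.\<close>
    have "sat M (\<lambda>_. c) (Eq (Fn F (map (\<lambda>f. App f (Var 0)) fs)) (App (\<lambda>n. snd F (map (\<lambda>f. f n) fs)) (Var 0)))"
      by (rule transfer) (use F as fs c in \<open>simp_all add: list_all_iff o_def\<close>)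
    then show "fint M F as \<in> S"
      by (auto simp: fs o_def S_def generated_def)
  qed
  have tm_val: "tm_val K s t = tm_val M s t" for s t
  proof (induction t)
    case (Fn F ts)
    then have "map (tm_val K s) ts = map (tm_val M s) ts"
      by simp
    then show ?case
      by (simp only: tm_val.simps K)
  qed simp
  have "sat K s \<phi> \<longleftrightarrow> sat M s \<phi>" if "L_formula \<phi>" "range s \<subseteq> S" for \<phi> s
    using that
  proof (induction \<phi> arbitrary: s)
    case (Rl R ts)
    have "map (tm_val K s) ts = map (tm_val M s) ts"
      by (simp add: tm_val)
    then show ?case
      by (simp only: sat.simps K)
  next
    case (Ex x \<phi>)
    have upd: "range (s(x := a)) \<subseteq> S" if "a \<in> S" for a
      using Ex.prems that by (auto simp: image_subset_iff)
    have IH: "sat K (s(x := a)) \<phi> \<longleftrightarrow> sat M (s(x := a)) \<phi>" if "a \<in> S" for a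
      using Ex.prems upd[OF that] by (intro Ex.IH) auto
    have "\<exists>\<sigma>. \<forall>y. s y = star_fun M (\<sigma> y) c"
      using Ex.prems by (intro choice) (auto simp: S_def generated_def)
    then obtain \<sigma> where \<sigma>: "s = (\<lambda>y. star_fun M (\<sigma> y) c)"
      by blast
    \<comment> \<open>Where no witness exists, \<open>h n\<close> is arbitrary and both sides of the
      next equivalence are false.\<close>
    define h where "h n = (SOME m. sat std_model ((\<lambda>y. \<sigma> y n)(x := m)) \<phi>)" for n
    have h: "(\<exists>m. sat std_model ((\<lambda>y. \<sigma> y n)(x := m)) \<phi>) \<longleftrightarrow> sat std_model ((\<lambda>y. \<sigma> y n)(x := h n)) \<phi>" for n
      unfolding h_def by (metis someI_ex)
    have "sat M s (Ex x \<phi>) \<longleftrightarrow> c \<in> star_set M {n. sat std_model (\<lambda>y. \<sigma> y n) (Ex x \<phi>)}"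
      unfolding \<sigma> using Ex.prems(1) c by (rule sat_star_fun)
    also have "{n. sat std_model (\<lambda>y. \<sigma> y n) (Ex x \<phi>)} = {n. sat std_model (\<lambda>y. (\<sigma>(x := h)) y n) \<phi>}"
      using h by (auto simp: fun_upd_def if_distribR cong: if_cong)
    also have "c \<in> star_set M \<dots> \<longleftrightarrow> sat M (\<lambda>y. star_fun M ((\<sigma>(x := h)) y) c) \<phi>"
      using sat_star_fun[of \<phi> c "\<sigma>(x := h)"] Ex.prems c by simp
    also have "(\<lambda>y. star_fun M ((\<sigma>(x := h)) y) c) = s(x := star_fun M h c)"
      by (auto simp: \<sigma>)
    finally have "sat M s (Ex x \<phi>) \<longleftrightarrow> sat M (s(x := star_fun M h c)) \<phi>" .
    moreover have "star_fun M h c \<in> S"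
      by (auto simp: S_def generated_def)
    ultimately show ?case
      using IH S_Dom by (auto simp: K)
  qed (auto simp: tm_val)
  then have "elementary_embedding (\<lambda>x. x) K M"
    using \<open>L_structure K\<close> L_structure S_Dom
    by (simp add: elementary_embedding_def K o_def)
  then show ?thesis
    using S_Dom by (simp add: submodel_def S_def K_def)
qed

lemma principal_submodel_generated: "c \<in> Dom M \<Longrightarrow> principal_submodel M (generated M c)"
  using submodel_generated by (auto simp: principal_submodel_def)

lemma generated_subset: "submodel M S \<Longrightarrow> c \<in> S \<Longrightarrow> generated M c \<subseteq> S"
  by (auto simp: generated_def submodel_star_fun)

lemma generator_mem: "c \<in> Dom M \<Longrightarrow> c \<in> generated M c"
  using star_fun_id[of c] unfolding generated_def by (metis (mono_tags, lifting) mem_Collect_eq)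

lemma cofinal_with_subset:
  assumes "S \<subseteq> A" "A \<subseteq> Dom M" "\<And>a. a \<in> A \<Longrightarrow> \<exists>b\<in>S. star_le M a b"
  shows "cofinal_with M S A"
  using assms star_le_refl unfolding cofinal_with_def by (meson subsetD)

end

section \<open>A common principal submodel cofinal with all \<open>Ms i\<close>\<close>

theorem theorem2p8:
  fixes \<alpha> :: "'i rel" and z :: 'i
    and M :: "'m struct" and e :: "nat \<Rightarrow> 'm"
    and Ms :: "'i \<Rightarrow> 'm set" and a\<^sub>0 :: 'm
  assumes "|UNIV :: real set| \<le>o |UNIV :: 'p set|"
    and "Well_order \<alpha>" and "z \<in> Field \<alpha>" and "\<forall>i\<in>Field \<alpha>. (z, i) \<in> \<alpha>"
    and "MA TYPE('p) \<alpha>"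
    and "elementary_embedding e std_model M"
    and "\<forall>i\<in>Field \<alpha>. submodel M (Ms i)"
    and "\<forall>i\<in>Field \<alpha>. \<forall>j\<in>Field \<alpha>. cofinal_with M (Ms i) (Ms j)"
    and "principal_submodel M (Ms z)"
    and "a\<^sub>0 \<in> Dom M" and "Ms z = generated M a\<^sub>0"
    and "Pc_point {X. a\<^sub>0 \<in> star_set M X}"
  shows "\<exists>S. principal_submodel M S \<and> S \<subseteq> (\<Inter>i\<in>Field \<alpha>. Ms i) \<and>
           (\<forall>i\<in>Field \<alpha>. cofinal_with M S (Ms i))"
proof -
  interpret elementary_extension M e
    by unfold_locales fact
  note Ms = \<open>\<forall>i\<in>Field \<alpha>. submodel M (Ms i)\<close>[rule_format]
  note cofinal = \<open>\<forall>i\<in>Field \<alpha>. \<forall>j\<in>Field \<alpha>. cofinal_with M (Ms i) (Ms j)\<close>[rule_format, OF \<open>z \<in> Field \<alpha>\<close>]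
  note z = \<open>Ms z = generated M a\<^sub>0\<close> and a\<^sub>0 = \<open>a\<^sub>0 \<in> Dom M\<close>
  have Ms_Dom: "x \<in> Dom M" if "i \<in> Field \<alpha>" "x \<in> Ms i" for i x
    using Ms[OF that(1)] that(2) by (auto simp: submodel_def)
  have below: "\<exists>k. star_le M x (star_fun M k a\<^sub>0)" if "i \<in> Field \<alpha>" "x \<in> Ms i" for i x
    using cofinal[OF that(1)] that(2) by (auto simp: cofinal_with_def z generated_def)
  show ?thesis
  proof (cases "\<exists>k. a\<^sub>0 \<in> star_set M {..<k}")
    case True
    then obtain k where k: "a\<^sub>0 \<in> star_set M {..<k}" ..
    \<comment> \<open>Here \<open>a\<^sub>0\<close> is standard and so lies in every
      \<open>Ms i\<close>; \<open>Ms z\<close> itself is the required submodel.\<close>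
    have "Ms z \<subseteq> Ms i" if i: "i \<in> Field \<alpha>" for i
    proof -
      obtain w where w: "w \<in> Ms i"
        using submodel_nonempty[OF Ms[OF i]] by blast
      obtain m where "a\<^sub>0 = star_fun M (\<lambda>_. m) w"
        using star_set_lessThan_const[OF k Ms_Dom[OF i w]] by blast
      then have "a\<^sub>0 \<in> Ms i"
        using submodel_star_fun[OF Ms[OF i] w] by simp
      then show ?thesis
        unfolding z by (rule generated_subset[OF Ms[OF i]])
    qed
    then show ?thesis
      using \<open>principal_submodel M (Ms z)\<close> cofinal by blast
  next
    case False
    have "\<exists>b g. b \<in> Ms i \<and> star_le M a\<^sub>0 b \<and> star_le M b (star_fun M g a\<^sub>0)" if i: "i \<in> Field \<alpha>" for i
    proof -
      obtain b where "b \<in> Ms i" "star_le M a\<^sub>0 b"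
        using cofinal[OF i] generator_mem[OF a\<^sub>0] unfolding cofinal_with_def z by blast
      then show ?thesis
        using below[OF i] by blast
    qed
    then obtain b G where b: "\<And>i. i \<in> Field \<alpha> \<Longrightarrow> b i \<in> Ms i"
      and b_ge: "\<And>i. i \<in> Field \<alpha> \<Longrightarrow> star_le M a\<^sub>0 (b i)"
      and b_le: "\<And>i. i \<in> Field \<alpha> \<Longrightarrow> star_le M (b i) (star_fun M (G i) a\<^sub>0)"
      by metis
    obtain g where g: "\<And>i. i \<in> Field \<alpha> \<Longrightarrow> \<exists>k. \<forall>n\<ge>k. G i n \<le> g n"
      using MA_dominating[OF \<open>MA TYPE('p) \<alpha>\<close> assms(1), of G] by blast
    have b_le_g: "star_le M (b i) (star_fun M g a\<^sub>0)" if i: "i \<in> Field \<alpha>" for i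
    proof -
      obtain k where "\<And>n. n \<ge> k \<Longrightarrow> G i n \<le> g n"
        using g[OF i] by blast
      then have "star_le M (star_fun M (G i) a\<^sub>0) (star_fun M g a\<^sub>0)"
        using False a\<^sub>0 by (intro star_fun_le) auto
      then show ?thesis
        using star_le_trans[OF b_le[OF i]] Ms_Dom[OF i b[OF i]] a\<^sub>0 by simp
    qed
    obtain f :: "bool \<Rightarrow> nat \<Rightarrow> nat" and E and u :: "nat \<Rightarrow> nat"
      where f: "\<And>x y. x \<le> y \<Longrightarrow> y \<le> g x \<Longrightarrow> f (x \<in> E) x = f (x \<in> E) y"
      and u: "\<And>B x. x \<le> u (f B x)"
      using interval_partition[of g] by blast
    \<comment> \<open>The parity of the interval of \<open>a\<^sub>0\<close> fixes one merging
      \<open>f B\<close>, the same for all \<open>i\<close>.\<close>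
    define B where "B \<longleftrightarrow> a\<^sub>0 \<in> star_set M E"
    define E' where "E' = (if B then E else - E)"
    define c where "c = star_fun M (f B) a\<^sub>0"
    have E': "a\<^sub>0 \<in> star_set M E'"
      using star_set_Compl[OF a\<^sub>0] by (simp add: E'_def B_def)
    have c: "c \<in> Dom M"
      using a\<^sub>0 by (simp add: c_def)
    have c_Ms: "c \<in> Ms i" if i: "i \<in> Field \<alpha>" for i
    proof -
      \<comment> \<open>Over \<omega>, \<open>x \<in> E'\<close> and
        \<open>x \<le> y \<le> g x\<close> give equal labels. At \<open>a\<^sub>0\<close> and
        \<open>b i\<close> this makes \<open>c\<close> a value at \<open>b i\<close> as
        well.\<close>
      have "sat M ((\<lambda>_. a\<^sub>0)(1 := b i))
        (Imp (Conj (Mem (Var 0) E') (Conj (Le (Var 0) (Var 1)) (Le (Var 1) (App g (Var 0)))))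
          (Eq (App (f B) (Var 0)) (App (f B) (Var 1))))"
      proof (rule transfer)
        show "sat std_model s
          (Imp (Conj (Mem (Var 0) E') (Conj (Le (Var 0) (Var 1)) (Le (Var 1) (App g (Var 0)))))
            (Eq (App (f B) (Var 0)) (App (f B) (Var 1))))" for s
          using f[of "s 0" "s 1"] by (auto simp: E'_def split: if_splits)
      qed (use a\<^sub>0 Ms_Dom[OF i b[OF i]] in auto)
      then have "c = star_fun M (f B) (b i)"
        using E' a\<^sub>0 b_ge[OF i] b_le_g[OF i] by (simp add: c_def)
      then show ?thesis
        using submodel_star_fun[OF Ms[OF i] b[OF i]] by simp
    qed
    have subset: "generated M c \<subseteq> Ms i" if "i \<in> Field \<alpha>" for i
      using that by (intro generated_subset Ms c_Ms)
    have "cofinal_with M (generated M c) (Ms i)" if i: "i \<in> Field \<alpha>" for i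
    proof (rule cofinal_with_subset)
      fix x
      assume x: "x \<in> Ms i"
      obtain k where k: "star_le M x (star_fun M k a\<^sub>0)"
        using below[OF i x] by blast
      \<comment> \<open>The fibre of \<open>f B\<close> over \<open>m\<close> lies in
        \<open>{..u m}\<close>, so \<open>h m\<close> bounds \<open>k\<close> on it; hence
        \<open>k\<close> at \<open>a\<^sub>0\<close> is at most \<open>h\<close> at
        \<open>c\<close>.\<close>
      define h where "h m = (\<Sum>y\<le>u m. k y)" for m
      have "k n \<le> h (f B n)" for n
        unfolding h_def using u[of n B] by (intro member_le_sum) auto
      then have "star_le M (star_fun M k a\<^sub>0) (star_fun M (\<lambda>n. h (f B n)) a\<^sub>0)"
        using a\<^sub>0 by (intro star_fun_le[of 0]) (auto simp: star_set_empty)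
      then have "star_le M (star_fun M k a\<^sub>0) (star_fun M h c)"
        using a\<^sub>0 by (simp add: c_def star_fun_comp)
      then have "star_le M x (star_fun M h c)"
        using star_le_trans[OF k] Ms_Dom[OF i x] a\<^sub>0 c by simp
      then show "\<exists>y\<in>generated M c. star_le M x y"
        by (auto simp: generated_def)
    qed (use subset[OF i] Ms_Dom[OF i] in auto)
    then show ?thesis
      using principal_submodel_generated[OF c] subset by blast
  qed
qed

end
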